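(* Let $0<s<1$, $N\ge 2$, let $m:[0,\infty)\to[0,\infty)$ be a $C^1$ function and $M(t)=\int_0^{|t|}m(\tau)\tau\,d\tau$. Assume that $m(t)>0$ and $(m(t)t)'>0$ for all $t>0$; that there are $l,r\in(1,N)$ with $l\le r<l^*:=\frac{Nl}{N-l}$ and $l\le \frac{m(|t|)t^2}{M(t)}\le r$ for all $t\neq0$; and that $V\in C(\mathbb R^N,\mathbb R)$ satisfies $\inf_{x\in\mathbb R^N}V(x)\ge V_0>0$. Let $\xi_0(t)=\min\{t^l,t^r\}$ and $\xi_1(t)=\max\{t^l,t^r\}$ for $t\ge0$. Then: (i) $\xi_0([u]_{(s,M)})\le G(u)\le \xi_1([u]_{(s,M)})$ for all $u\in E$; (ii) $\xi_0(\|u\|_{(V,M)})\le\displaystyle\int_{\mathbb R^N}V(x)M(u)\,dx\le\xi_1(\|u\|_{(V,M)})$ for all $u\in E$.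
   Context: $M^{-1}$ is the inverse of $M$ on $[0,\infty)$. $L^M(\mathbb R^N)$ is the Orlicz space of (classes of) measurable $u$ with $\int_{\mathbb R^N} M(\lambda u)\,dx<\infty$ for some $\lambda>0$. For measurable $u$ set $$h_u(x,y)=\frac{u(x)-u(y)}{|x-y|^sM^{-1}(|x-y|^N)}.$$ $W^{s,M}(\mathbb R^N)$ is the set of $u\in L^M(\mathbb R^N)$ for which there is $\lambda>0$ with $\int_{\mathbb R^N}\int_{\mathbb R^N}M(\lambda h_u(x,y))\,dx\,dy<\infty$. Define $$[u]_{(s,M)}=\inf\Big\{\lambda>0:\int_{\mathbb R^N}\int_{\mathbb R^N} M\Big(\frac{h_u(x,y)}{\lambda}\Big)dx\,dy\le 1\Big\},\qquad \|u\|_{(V,M)}=\inf\Big\{\lambda>0:\int_{\mathbb R^N}V(x)M\Big(\frac u\lambda\Big)dx\le 1\Big\},$$ $E=\{u\in W^{s,M}(\mathbb R^N):\int_{\mathbb R^N}V(x)M(u)\,dx<\infty\}$, and $G(u)=\int_{\mathbb R^N}\int_{\mathbb R^N}M(h_u(x,y))\,dx\,dy$. *)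

theory Defs
  imports "HOL-Analysis.Analysis"
begin

text \<open>
  Elements of the function spaces are represented by (Lebesgue) measurable functions rather than
  by classes modulo null sets; all quantities below only depend on the class.
  Integrals of nonnegative functions are extended nonnegative integrals, so that finiteness
  can be expressed as \<open>< \<infinity>\<close>.
\<close>

text \<open>At the endpoint 0 the derivative is one-sided.\<close>

definition C1_on_nonneg :: "(real \<Rightarrow> real) \<Rightarrow> bool" where
  "C1_on_nonneg f \<longleftrightarrow>
     (\<exists>f'. (\<forall>t\<ge>0. (f has_real_derivative f' t) (at t within {0..})) \<and> continuous_on {0..} f')"

definition orlicz_space :: "(real \<Rightarrow> real) \<Rightarrow> (real ^ 'n \<Rightarrow> real) set" where
  "orlicz_space M = {u \<in> borel_measurable lebesgue.
     \<exists>c>0. (\<integral>\<^sup>+ x. ennreal (M (c * u x)) \<partial>lebesgue) < \<infinity>}"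

text \<open>On the diagonal \<open>x = y\<close>, which is a null set, the quotient has the value 0.\<close>

definition hquot :: "real \<Rightarrow> (real \<Rightarrow> real) \<Rightarrow> (real ^ 'n \<Rightarrow> real) \<Rightarrow> real ^ 'n \<Rightarrow> real ^ 'n \<Rightarrow> real" where
  "hquot s M u x y =
     (u x - u y) / (norm (x - y) powr s * the_inv_into {0..} M (norm (x - y) ^ CARD('n)))"

definition frac_orlicz_sobolev :: "real \<Rightarrow> (real \<Rightarrow> real) \<Rightarrow> (real ^ 'n \<Rightarrow> real) set" where
  "frac_orlicz_sobolev s M = {u \<in> orlicz_space M.
     \<exists>c>0. (\<integral>\<^sup>+ y. (\<integral>\<^sup>+ x. ennreal (M (c * hquot s M u x y)) \<partial>lebesgue) \<partial>lebesgue) < \<infinity>}"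

definition gagliardo_seminorm :: "real \<Rightarrow> (real \<Rightarrow> real) \<Rightarrow> (real ^ 'n \<Rightarrow> real) \<Rightarrow> real" where
  "gagliardo_seminorm s M u = Inf {c. 0 < c \<and>
     (\<integral>\<^sup>+ y. (\<integral>\<^sup>+ x. ennreal (M (hquot s M u x y / c)) \<partial>lebesgue) \<partial>lebesgue) \<le> 1}"

definition weighted_norm :: "(real ^ 'n \<Rightarrow> real) \<Rightarrow> (real \<Rightarrow> real) \<Rightarrow> (real ^ 'n \<Rightarrow> real) \<Rightarrow> real" where
  "weighted_norm V M u = Inf {c. 0 < c \<and>
     (\<integral>\<^sup>+ x. ennreal (V x * M (u x / c)) \<partial>lebesgue) \<le> 1}"

definition weighted_modular :: "(real ^ 'n \<Rightarrow> real) \<Rightarrow> (real \<Rightarrow> real) \<Rightarrow> (real ^ 'n \<Rightarrow> real) \<Rightarrow> ennreal" where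
  "weighted_modular V M u = (\<integral>\<^sup>+ x. ennreal (V x * M (u x)) \<partial>lebesgue)"

definition E_space :: "real \<Rightarrow> (real \<Rightarrow> real) \<Rightarrow> (real ^ 'n \<Rightarrow> real) \<Rightarrow> (real ^ 'n \<Rightarrow> real) set" where
  "E_space s M V = {u \<in> frac_orlicz_sobolev s M. weighted_modular V M u < \<infinity>}"

definition G_modular :: "real \<Rightarrow> (real \<Rightarrow> real) \<Rightarrow> (real ^ 'n \<Rightarrow> real) \<Rightarrow> ennreal" where
  "G_modular s M u =
     (\<integral>\<^sup>+ y. (\<integral>\<^sup>+ x. ennreal (M (hquot s M u x y)) \<partial>lebesgue) \<partial>lebesgue)"

definition xi0 :: "real \<Rightarrow> real \<Rightarrow> real \<Rightarrow> real" where
  "xi0 l r t = min (t powr l) (t powr r)"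

definition xi1 :: "real \<Rightarrow> real \<Rightarrow> real \<Rightarrow> real" where
  "xi1 l r t = max (t powr l) (t powr r)"

end

theory Submission imports Defs begin

text \<open>
  The growth condition \<open>l \<le> t M'(t) / M(t) \<le> r\<close> says that \<open>M(t) / t\<^sup>l\<close> increases and
  \<open>M(t) / t\<^sup>r\<close> decreases on \<open>t > 0\<close>, hence \<open>M (k t) \<le> \<xi>\<^sub>1 k * M t\<close> for all \<open>k > 0\<close>
  (lemma \<open>xi1_scaling\<close>). Integrating this pointwise bound, both modulars in the theorem, read as
  functions \<open>J c\<close> of the dilation \<open>c\<close> by which the integrand is divided, satisfy
  \<open>J a \<le> \<xi>\<^sub>1 (b / a) * J b\<close>.

  Everything else follows from this one scaling property (lemma \<open>luxemburg_modular_bounds\<close>).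
  Let \<open>\<nu> = Inf {c > 0. J c \<le> 1}\<close>. Every \<open>c\<close> with \<open>J c \<le> 1\<close> has \<open>J 1 \<le> \<xi>\<^sub>1 c\<close>, and
  since \<open>\<xi>\<^sub>1 (1 / c) = 1 / \<xi>\<^sub>0 c\<close>, every \<open>c > 0\<close> with \<open>J c > 1\<close> has \<open>\<xi>\<^sub>0 c < J 1\<close>.
  By continuity of \<open>\<xi>\<^sub>0\<close> and \<open>\<xi>\<^sub>1\<close> both inequalities survive at \<open>\<nu>\<close>, approached from
  above and from below respectively. The limit is thus taken in the explicit functions \<open>\<xi>\<^sub>0\<close>
  and \<open>\<xi>\<^sub>1\<close> instead of in the modular.

  The pointwise bound is integrated by \<open>nn_integral_le_cmult\<close>, which holds for arbitrary
  functions and so applies directly to both layers of the iterated integral.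
\<close>

section \<open>Power growth from bounds on the logarithmic derivative\<close>

text \<open>
  The difference \<open>ln F - p ln\<close> has derivative \<open>F'/F - p/t\<close>, so its monotonicity is decided by the
  position of \<open>p\<close> relative to the elasticity \<open>t F'(t) / F(t)\<close>.
\<close>

lemma powr_growth_of_elasticity:
  fixes F F' :: "real \<Rightarrow> real"
  assumes der: "\<And>t. t > 0 \<Longrightarrow> (F has_real_derivative F' t) (at t)"
    and pos: "\<And>t. t > 0 \<Longrightarrow> F t > 0"
    and ab: "0 < a" "a \<le> b"
  shows powr_growth_lower: "(\<And>t. t > 0 \<Longrightarrow> p * F t \<le> t * F' t) \<Longrightarrow> (b / a) powr p * F a \<le> F b"
    and powr_growth_upper: "(\<And>t. t > 0 \<Longrightarrow> t * F' t \<le> p * F t) \<Longrightarrow> F b \<le> (b / a) powr p * F a"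
proof -
  define g where "g = (\<lambda>t. ln (F t) - p * ln t)"
  have g_der: "(g has_real_derivative F' t / F t - p / t) (at t)" if "t > 0" for t
    unfolding g_def using that pos[OF that]
    by (auto intro!: derivative_eq_intros der)
  have F_eq: "F t = exp (g t) * t powr p" if "t > 0" for t
    using that pos[OF that] by (simp add: g_def powr_def exp_diff)
  have quot: "(b / a) powr p * F a = exp (g a) * b powr p"
    using ab F_eq[of a] by (simp add: powr_divide)
  show "(b / a) powr p * F a \<le> F b" if h: "\<And>t. t > 0 \<Longrightarrow> p * F t \<le> t * F' t"
  proof -
    have "g a \<le> g b"
    proof (rule DERIV_nonneg_imp_nondecreasing[OF ab(2)])
      fix t assume "a \<le> t" "t \<le> b"
      then have t: "t > 0" using ab by simp
      then show "\<exists>y. (g has_real_derivative y) (at t) \<and> 0 \<le> y"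
        using h[OF t] pos[OF t] g_der[OF t] by (auto simp: field_simps intro!: exI)
    qed
    then show ?thesis
      using quot F_eq[of b] ab by simp
  qed
  show "F b \<le> (b / a) powr p * F a" if h: "\<And>t. t > 0 \<Longrightarrow> t * F' t \<le> p * F t"
  proof -
    have "g b \<le> g a"
    proof (rule DERIV_nonpos_imp_nonincreasing[OF ab(2)])
      fix t assume "a \<le> t" "t \<le> b"
      then have t: "t > 0" using ab by simp
      then show "\<exists>y. (g has_real_derivative y) (at t) \<and> y \<le> 0"
        using h[OF t] pos[OF t] g_der[OF t] by (auto simp: field_simps intro!: exI)
    qed
    then show ?thesis
      using quot F_eq[of b] ab by simp
  qed
qed

text \<open>
  Dilations \<open>k \<ge> 1\<close> are controlled by the upper exponent and dilations \<open>k \<le> 1\<close> by the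
  lower one; the maximum in \<open>xi1\<close> covers both.
\<close>

lemma xi1_scaling:
  fixes F F' :: "real \<Rightarrow> real"
  assumes der: "\<And>t. t > 0 \<Longrightarrow> (F has_real_derivative F' t) (at t)"
    and pos: "\<And>t. t > 0 \<Longrightarrow> F t > 0"
    and lower: "\<And>t. t > 0 \<Longrightarrow> l * F t \<le> t * F' t"
    and upper: "\<And>t. t > 0 \<Longrightarrow> t * F' t \<le> r * F t"
    and kt: "0 < k" "0 < t"
  shows "F (k * t) \<le> xi1 l r k * F t"
proof (cases "1 \<le> k")
  case True
  have "F (k * t) \<le> (k * t / t) powr r * F t"
    using powr_growth_upper[OF der pos, of t "k * t" r] upper kt True by simp
  also have "\<dots> \<le> xi1 l r k * F t"
    using pos[OF kt(2)] kt by (intro mult_right_mono) (auto simp: xi1_def)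
  finally show ?thesis .
next
  case False
  have "(t / (k * t)) powr l * F (k * t) \<le> F t"
    using powr_growth_lower[OF der pos, of "k * t" t l] lower kt False
    by (simp add: mult_le_cancel_right1)
  then have "F (k * t) \<le> k powr l * F t"
    using kt by (simp add: powr_divide field_simps)
  also have "\<dots> \<le> xi1 l r k * F t"
    using pos[OF kt(2)] by (intro mult_right_mono) (auto simp: xi1_def)
  finally show ?thesis .
qed

section \<open>Scaling of integrals of arbitrary nonnegative functions\<close>

text \<open>
  Dividing by the positive constant \<open>c\<close> maps the simple functions below \<open>f\<close> to simple functions
  below \<open>g\<close>, so the suprema that define the two integrals for arbitrary functions compare directly.
\<close>

lemma nn_integral_le_cmult:
  assumes c: "0 < c" and le: "\<And>x. f x \<le> ennreal c * g x"
  shows "(\<integral>\<^sup>+ x. f x \<partial>\<mu>) \<le> ennreal c * (\<integral>\<^sup>+ x. g x \<partial>\<mu>)"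
  unfolding nn_integral_def[of \<mu> f]
proof (rule SUP_least, clarify)
  fix \<phi> assume \<phi>: "simple_function \<mu> \<phi>" "\<phi> \<le> f"
  define \<psi> where "\<psi> = (\<lambda>x. ennreal (1 / c) * \<phi> x)"
  have inv: "ennreal c * (ennreal (1 / c) * z) = z" "ennreal (1 / c) * (ennreal c * z) = z" for z
    using c by (simp_all flip: mult.assoc ennreal_mult)
  have \<psi>_simple: "simple_function \<mu> \<psi>"
    unfolding \<psi>_def using \<phi>(1) by auto
  have "\<psi> x \<le> g x" for x
  proof -
    have "\<psi> x \<le> ennreal (1 / c) * (ennreal c * g x)"
      unfolding \<psi>_def using \<phi>(2) le[of x] by (intro mult_left_mono) (auto simp: le_fun_def intro: order_trans)
    then show ?thesis by (simp only: inv)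
  qed
  then have "integral\<^sup>S \<mu> \<psi> \<le> integral\<^sup>N \<mu> g"
    unfolding nn_integral_def using \<psi>_simple by (intro SUP_upper) (auto simp: le_fun_def)
  moreover have "integral\<^sup>S \<mu> \<phi> = ennreal c * integral\<^sup>S \<mu> \<psi>"
    unfolding simple_integral_mult[OF \<psi>_simple, symmetric] by (simp add: \<psi>_def inv)
  ultimately show "integral\<^sup>S \<mu> \<phi> \<le> ennreal c * integral\<^sup>N \<mu> g"
    by (simp add: mult_left_mono)
qed

section \<open>The Luxemburg functional of a modular with power scaling\<close>

lemma xi1_pos: "0 < c \<Longrightarrow> 0 < xi1 l r c"
  by (simp add: xi1_def less_max_iff_disj)

lemma xi0_pos: "0 < c \<Longrightarrow> 0 < xi0 l r c"
  by (simp add: xi0_def)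

lemma xi1_inverse: "0 < c \<Longrightarrow> xi1 l r (1 / c) = 1 / xi0 l r c"
  by (auto simp: xi1_def xi0_def powr_divide max_def min_def field_simps)

lemma continuous_on_xi0: "0 < l \<Longrightarrow> 0 < r \<Longrightarrow> continuous_on {0..} (xi0 l r)"
  unfolding xi0_def by (intro continuous_on_max continuous_on_min continuous_on_powr' continuous_intros) auto

lemma continuous_on_xi1: "0 < l \<Longrightarrow> 0 < r \<Longrightarrow> continuous_on {0..} (xi1 l r)"
  unfolding xi1_def by (intro continuous_on_max continuous_on_min continuous_on_powr' continuous_intros) auto

text \<open>
  Here \<open>J c\<close> plays the role of the modular of \<open>u / c\<close>, and the infimum is the Luxemburg
  functional of \<open>u\<close>. Finiteness at one dilation suffices, since the scaling property carries it
  to \<open>J 1\<close>.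
\<close>

lemma luxemburg_modular_bounds:
  fixes J :: "real \<Rightarrow> ennreal"
  assumes lr: "0 < l" "0 < r"
    and scaling: "\<And>a b. 0 < a \<Longrightarrow> 0 < b \<Longrightarrow> J a \<le> ennreal (xi1 l r (b / a)) * J b"
    and fin: "0 < c0" "J c0 < \<infinity>"
  shows "ennreal (xi0 l r (Inf {c. 0 < c \<and> J c \<le> 1})) \<le> J 1"
    and "J 1 \<le> ennreal (xi1 l r (Inf {c. 0 < c \<and> J c \<le> 1}))"
proof -
  define S where "S = {c. 0 < c \<and> J c \<le> 1}"
  have "J 1 \<le> ennreal (xi1 l r c0) * J c0"
    using scaling[of 1 c0] fin by simp
  also have "\<dots> < \<infinity>"
    using fin by (simp add: ennreal_mult_less_top)
  finally obtain g where g: "0 \<le> g" "J 1 = ennreal g"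
    by (cases "J 1") auto
  have upper: "g \<le> xi1 l r c" if "c \<in> S" for c
  proof -
    have "ennreal g \<le> ennreal (xi1 l r c) * J c"
      using scaling[of 1 c] that g by (simp add: S_def)
    also have "\<dots> \<le> ennreal (xi1 l r c) * 1"
      using that by (intro mult_left_mono) (auto simp: S_def)
    finally show ?thesis
      using that xi1_pos[of c l r] by (simp add: S_def)
  qed
  have mem: "c \<in> S" if "0 < c" "g \<le> xi0 l r c" for c
  proof -
    have "J c \<le> ennreal (1 / xi0 l r c) * ennreal g"
      using scaling[of c 1] that g by (simp add: xi1_inverse)
    also have "\<dots> = ennreal (g / xi0 l r c)"
      using g xi0_pos[OF that(1), of l r] by (simp flip: ennreal_mult)
    also have "\<dots> \<le> 1"
      using that xi0_pos[OF that(1), of l r] by simp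
    finally show ?thesis using that by (simp add: S_def)
  qed
  \<comment> \<open>The set is nonempty because \<open>xi0\<close> is unbounded: this \<open>c\<close> satisfies \<open>c powr p \<ge> g\<close> for both exponents.\<close>
  define c where "c = max 1 (max (g powr (1 / l)) (g powr (1 / r)))"
  have "g \<le> c powr p" if "p = l \<or> p = r" for p
  proof -
    have "0 < p" using that lr by auto
    have "g = (g powr (1 / p)) powr p"
      using g \<open>0 < p\<close> by (simp add: powr_powr)
    also have "\<dots> \<le> c powr p"
      using that \<open>0 < p\<close> by (intro powr_mono2) (auto simp: c_def)
    finally show ?thesis .
  qed
  then have "c \<in> S"
    by (intro mem) (auto simp: c_def xi0_def)
  then have S: "S \<noteq> {}" by auto
  have bdd: "bdd_below S"
    by (rule bdd_belowI[of _ 0]) (auto simp: S_def)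
  have Inf_nonneg: "0 \<le> Inf S"
    using S by (intro cInf_greatest) (auto simp: S_def)

  have "closed {c \<in> {0..}. g \<le> xi1 l r c}"
    by (intro continuous_on_closed_Collect_le continuous_on_const continuous_on_xi1 lr closed_atLeast)
  then have "Inf S \<in> {c \<in> {0..}. g \<le> xi1 l r c}"
    using upper S bdd by (intro closed_subset_contains_Inf) (auto simp: S_def)
  then show "J 1 \<le> ennreal (xi1 l r (Inf {c. 0 < c \<and> J c \<le> 1}))"
    by (simp add: S_def g ennreal_leI)

  have "xi0 l r (Inf S) \<le> g"
  proof (cases "Inf S = 0")
    case True
    then show ?thesis using g by (simp add: xi0_def)
  next
    case False
    have "closed {c \<in> {0..}. xi0 l r c \<le> g}"
      by (intro continuous_on_closed_Collect_le continuous_on_const continuous_on_xi0 lr closed_atLeast)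
    moreover have "{0<..<Inf S} \<subseteq> {c \<in> {0..}. xi0 l r c \<le> g}"
    proof
      fix c assume c: "c \<in> {0<..<Inf S}"
      then have "c \<notin> S" using cInf_lower[OF _ bdd, of c] by auto
      then have "\<not> g \<le> xi0 l r c"
        using mem[of c] c by auto
      then show "c \<in> {c \<in> {0..}. xi0 l r c \<le> g}"
        using c by auto
    qed
    ultimately have "closure {0<..<Inf S} \<subseteq> {c \<in> {0..}. xi0 l r c \<le> g}"
      by (rule closure_minimal[rotated])
    then show ?thesis
      using False Inf_nonneg by (auto simp: closure_greaterThanLessThan)
  qed
  then show "ennreal (xi0 l r (Inf {c. 0 < c \<and> J c \<le> 1})) \<le> J 1"
    by (simp add: S_def g ennreal_leI)
qed

section \<open>The two modulars of the space\<close>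

theorem lemma3p3:
  fixes s l r V0 :: real
    and m M :: "real \<Rightarrow> real"
    and V :: "real ^ 'n \<Rightarrow> real"
    and N :: nat
  assumes N: "N = CARD('n)" "N \<ge> 2"
    and s: "0 < s" "s < 1"
    and m_nonneg: "\<forall>t\<ge>0. 0 \<le> m t"
    and m_C1: "C1_on_nonneg m"
    and M: "\<forall>t. M t = integral {0..\<bar>t\<bar>} (\<lambda>\<tau>. m \<tau> * \<tau>)"
    and m_pos: "\<forall>t>0. 0 < m t"
    and mt_deriv_pos: "\<forall>t>0. 0 < deriv (\<lambda>t. m t * t) t"
    and l: "1 < l" "l < real N"
    and r: "1 < r" "r < real N"
    and lr: "l \<le> r" "r < real N * l / (real N - l)"
    and growth: "\<forall>t. t \<noteq> 0 \<longrightarrow> l \<le> m \<bar>t\<bar> * t\<^sup>2 / M t \<and> m \<bar>t\<bar> * t\<^sup>2 / M t \<le> r"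
    and V_cont: "continuous_on UNIV V"
    and V_inf: "ereal V0 \<le> (INF x. ereal (V x))" "0 < V0"
  shows "(\<forall>u \<in> E_space s M V.
            ennreal (xi0 l r (gagliardo_seminorm s M u)) \<le> G_modular s M u \<and>
            G_modular s M u \<le> ennreal (xi1 l r (gagliardo_seminorm s M u))) \<and>
         (\<forall>u \<in> E_space s M V.
            ennreal (xi0 l r (weighted_norm V M u)) \<le> weighted_modular V M u \<and>
            weighted_modular V M u \<le> ennreal (xi1 l r (weighted_norm V M u)))"
proof -
  have m_cont: "continuous_on {0..} m"
    using m_C1 by (auto simp: C1_on_nonneg_def continuous_on_eq_continuous_within
        intro: DERIV_continuous)
  \<comment> \<open>\<open>M t \<le> 0\<close> would make the quotient in the growth condition nonpositive, contradicting \<open>l > 1\<close>.\<close>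
  have M_pos: "0 < M t" if "t > 0" for t
  proof (rule ccontr)
    assume "\<not> 0 < M t"
    then have "m t * t\<^sup>2 / M t \<le> 0"
      using m_pos that by (intro divide_nonneg_nonpos) (auto intro: less_imp_le)
    then show False using growth[rule_format, of t] that l by simp
  qed
  have M_der: "(M has_real_derivative m t * t) (at t)" if t: "t > 0" for t
  proof -
    have "((\<lambda>x. integral {0..x} (\<lambda>\<tau>. m \<tau> * \<tau>)) has_real_derivative m t * t) (at t within {0..t + 1})"
      using t by (intro integral_has_real_derivative continuous_intros
          continuous_on_subset[OF m_cont]) auto
    then have "((\<lambda>x. integral {0..x} (\<lambda>\<tau>. m \<tau> * \<tau>)) has_real_derivative m t * t) (at t)"
      using t by (simp add: at_within_Icc_at)
    then show ?thesis
    proof (rule DERIV_cong_ev[THEN iffD1, rotated 3])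
      show "\<forall>\<^sub>F x in nhds t. integral {0..x} (\<lambda>\<tau>. m \<tau> * \<tau>) = M x"
        using eventually_nhds_in_open[of "{0<..}" t] t
        by (auto elim!: eventually_mono simp: M)
    qed auto
  qed
  have M_growth: "l * M t \<le> t * (m t * t)" "t * (m t * t) \<le> r * M t" if "t > 0" for t
    using growth[rule_format, of t] M_pos[OF that] that
    by (simp_all add: field_simps power2_eq_square)
  have M_zero: "M 0 = 0" using M by simp
  have M_abs: "M \<bar>t\<bar> = M t" for t using M by simp
  have M_nonneg: "0 \<le> M t" for t
    using M_pos[of "\<bar>t\<bar>"] M_zero M_abs[of t] by (cases "t = 0") auto
  have M_scale: "M (k * t) \<le> xi1 l r k * M t" if "0 < k" for k t
  proof (cases "t = 0")
    case False
    then have "M (k * \<bar>t\<bar>) \<le> xi1 l r k * M \<bar>t\<bar>"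
      using that by (intro xi1_scaling[OF M_der M_pos M_growth]) auto
    then show ?thesis
      using that M_abs[of "k * t"] by (simp add: abs_mult M_abs)
  qed (simp add: M_zero)
  have M_div: "M (z / a) \<le> xi1 l r (b / a) * M (z / b)" if "0 < a" "0 < b" for z a b
    using M_scale[of "b / a" "z / b"] that by simp

  have lr_pos: "0 < l" "0 < r" using l r by simp_all
  have V_nonneg: "0 \<le> V x" for x
  proof -
    have "ereal V0 \<le> ereal (V x)"
      using V_inf(1) by (rule order_trans) (rule INF_lower, simp)
    then show ?thesis using V_inf(2) by simp
  qed

  have part_i: "ennreal (xi0 l r (gagliardo_seminorm s M u)) \<le> G_modular s M u \<and>
      G_modular s M u \<le> ennreal (xi1 l r (gagliardo_seminorm s M u))"
    if u: "u \<in> E_space s M V" for u :: "real ^ 'n \<Rightarrow> real"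
  proof -
    define J where "J = (\<lambda>c. \<integral>\<^sup>+ y. (\<integral>\<^sup>+ x. ennreal (M (hquot s M u x y / c)) \<partial>lebesgue) \<partial>lebesgue)"
    have scaling: "J a \<le> ennreal (xi1 l r (b / a)) * J b" if ab: "0 < a" "0 < b" for a b
    proof -
      have k: "0 < xi1 l r (b / a)" using ab by (simp add: xi1_pos)
      have "ennreal (M (z / a)) \<le> ennreal (xi1 l r (b / a)) * ennreal (M (z / b))" for z
        using M_div[OF ab, of z] M_nonneg k by (simp flip: ennreal_mult add: ennreal_leI)
      then show ?thesis
        unfolding J_def by (intro nn_integral_le_cmult k)
    qed
    obtain c where c: "0 < c"
      "(\<integral>\<^sup>+ y. (\<integral>\<^sup>+ x. ennreal (M (c * hquot s M u x y)) \<partial>lebesgue) \<partial>lebesgue) < \<infinity>"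
      using u by (auto simp: E_space_def frac_orlicz_sobolev_def)
    then have fin: "0 < 1 / c" "J (1 / c) < \<infinity>"
      by (simp_all add: J_def mult.commute)
    have "J 1 = G_modular s M u" by (simp add: J_def G_modular_def)
    moreover have "Inf {c. 0 < c \<and> J c \<le> 1} = gagliardo_seminorm s M u"
      by (simp add: J_def gagliardo_seminorm_def)
    ultimately show ?thesis
      using luxemburg_modular_bounds[OF lr_pos scaling fin] by simp
  qed
  have part_ii: "ennreal (xi0 l r (weighted_norm V M u)) \<le> weighted_modular V M u \<and>
      weighted_modular V M u \<le> ennreal (xi1 l r (weighted_norm V M u))"
    if u: "u \<in> E_space s M V" for u :: "real ^ 'n \<Rightarrow> real"
  proof -
    define J where "J = (\<lambda>c. \<integral>\<^sup>+ x. ennreal (V x * M (u x / c)) \<partial>lebesgue)"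
    have scaling: "J a \<le> ennreal (xi1 l r (b / a)) * J b" if ab: "0 < a" "0 < b" for a b
    proof -
      have k: "0 < xi1 l r (b / a)" using ab by (simp add: xi1_pos)
      have "V x * M (u x / a) \<le> xi1 l r (b / a) * (V x * M (u x / b))" for x
        using mult_left_mono[OF M_div[OF ab, of "u x"] V_nonneg[of x]] by (simp add: mult_ac)
      then have "ennreal (V x * M (u x / a))
          \<le> ennreal (xi1 l r (b / a)) * ennreal (V x * M (u x / b))" for x
        using M_nonneg V_nonneg k by (simp flip: ennreal_mult add: ennreal_leI)
      then show ?thesis
        unfolding J_def by (intro nn_integral_le_cmult k)
    qed
    have J1: "J 1 = weighted_modular V M u" by (simp add: J_def weighted_modular_def)
    then have fin: "0 < (1::real)" "J 1 < \<infinity>"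
      using u by (simp_all add: E_space_def)
    have "Inf {c. 0 < c \<and> J c \<le> 1} = weighted_norm V M u"
      by (simp add: J_def weighted_norm_def)
    then show ?thesis
      using luxemburg_modular_bounds[OF lr_pos scaling fin] J1 by simp
  qed
  show ?thesis using part_i part_ii by blast
qed

end
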